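(* Let $n\ge 2$ and $m\ge 2$ be integers. The number of tame friezes of width $m$ over the ring $\mathbb{Z}/n\mathbb{Z}$ is \[ \prod_{p\mid n}\frac{p^{(\nu_p(n)-1)(m-1)}\,\bigl(p^{m-1}+(-1)^m\bigr)(p-1)}{p+1}, \] where the product runs over the prime divisors $p$ of $n$.
   Context: For a prime $p$, $\nu_p(n)$ denotes the exponent of $p$ in the prime factorisation of $n$. Let $R=\mathbb{Z}/n\mathbb{Z}$. A frieze of width $m$ over $R$ is a family of entries $E(u,v)\in R$ indexed by all pairs of integers $(u,v)$ with $0\le v-u\le m$ (visualised as an array of $m+1$ bi-infinite rows offset alternately, the entry $E(u,v)$ lying in row $v-u$), such that $E(u,u)=E(u,u+m)=0$ for all $u\in\mathbb{Z}$ (the first and last rows are zero), and every diamond of four contiguous entries satisfies the unimodular rule: for all integers $u,v$ with $1\le v-u\le m-1$, \[ E(u,v)E(u+1,v+1)-E(u+1,v)E(u,v+1)=1 \text{ in } R. \] The frieze is tame if every diamond of nine contiguous entries has determinant zero: for all integers $u,v$ with $2\le v-u\le m-2$, the $3\times3$ determinant $\det\bigl(E(u+i,v+j)\bigr)_{i,j=0,1,2}$ equals $0$ in $R$. Friezes are counted as families of entries (two friezes are the same iff all entries agree). *)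

theory Defs
  imports Complex_Main "HOL-Library.FuncSet" "HOL-Number_Theory.Number_Theory"
begin

text \<open>
  HOL-Algebra has no determinants, so the $3 \times 3$ determinant over a ring with explicit
  carrier is written out by cofactor expansion along the first row; rows and columns are
  numbered 0, 1, 2.
\<close>

definition det3 :: "('a, 'b) ring_scheme \<Rightarrow> (int \<Rightarrow> int \<Rightarrow> 'a) \<Rightarrow> 'a" where
  "det3 R A =
    (A 0 0 \<otimes>\<^bsub>R\<^esub> (A 1 1 \<otimes>\<^bsub>R\<^esub> A 2 2 \<ominus>\<^bsub>R\<^esub> A 1 2 \<otimes>\<^bsub>R\<^esub> A 2 1)
      \<ominus>\<^bsub>R\<^esub> A 0 1 \<otimes>\<^bsub>R\<^esub> (A 1 0 \<otimes>\<^bsub>R\<^esub> A 2 2 \<ominus>\<^bsub>R\<^esub> A 1 2 \<otimes>\<^bsub>R\<^esub> A 2 0))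
      \<oplus>\<^bsub>R\<^esub> A 0 2 \<otimes>\<^bsub>R\<^esub> (A 1 0 \<otimes>\<^bsub>R\<^esub> A 2 1 \<ominus>\<^bsub>R\<^esub> A 1 1 \<otimes>\<^bsub>R\<^esub> A 2 0)"

definition frieze_index :: "nat \<Rightarrow> (int \<times> int) set" where
  "frieze_index m = {(u, v). 0 \<le> v - u \<and> v - u \<le> int m}"

text \<open>
  Membership in the extensional function space makes two friezes equal as HOL functions iff all
  their entries on \<^term>\<open>frieze_index m\<close> agree, so that the set of friezes can be counted by
  \<^const>\<open>card\<close>.
\<close>

definition frieze :: "('a, 'b) ring_scheme \<Rightarrow> nat \<Rightarrow> (int \<times> int \<Rightarrow> 'a) \<Rightarrow> bool" where
  "frieze R m E \<longleftrightarrow>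
     E \<in> frieze_index m \<rightarrow>\<^sub>E carrier R \<and>
     (\<forall>u. E (u, u) = \<zero>\<^bsub>R\<^esub> \<and> E (u, u + int m) = \<zero>\<^bsub>R\<^esub>) \<and>
     (\<forall>u v. 1 \<le> v - u \<and> v - u \<le> int m - 1 \<longrightarrow>
        E (u, v) \<otimes>\<^bsub>R\<^esub> E (u + 1, v + 1) \<ominus>\<^bsub>R\<^esub> E (u + 1, v) \<otimes>\<^bsub>R\<^esub> E (u, v + 1) = \<one>\<^bsub>R\<^esub>)"

definition tame_frieze :: "('a, 'b) ring_scheme \<Rightarrow> nat \<Rightarrow> (int \<times> int \<Rightarrow> 'a) \<Rightarrow> bool" where
  "tame_frieze R m E \<longleftrightarrow>
     frieze R m E \<and>
     (\<forall>u v. 2 \<le> v - u \<and> v - u \<le> int m - 2 \<longrightarrow>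
        det3 R (\<lambda>i j. E (u + i, v + j)) = \<zero>\<^bsub>R\<^esub>)"

end

theory Submission
  imports Defs
begin

text \<open>
  In a tame frieze the rows \<open>v \<mapsto> E(u,v)\<close> all satisfy one three-term recurrence
  \<open>E(u,v-1) + E(u,v+1) = J\<^sub>v E(u,v)\<close>, where \<open>J\<^sub>v = E(v-1,v+1) E(v,v+1)\<close>. The entries next to the two
  zero rows are units, so the frieze can be reconstructed from \<open>a = E(0,1)\<close> and
  \<open>J\<^sub>1, \<dots>, J\<^bsub>m-2\<^esub>\<close>. The only constraint is that \<open>a\<close> and the continuant \<open>K(J\<^sub>1, \<dots>, J\<^bsub>m-2\<^esub>)\<close> are
  units, since \<open>E(0,m-1)\<close> is their product; conversely such data give
  \<open>E(u,v) = a\<^bsup>\<plusminus>1\<^esup> det(w\<^sub>u, w\<^sub>v)\<close> for a path of plane vectors with \<open>w\<^bsub>i+m\<^esub>\<close> a unit multiple of \<open>w\<^sub>i\<close>.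

  The number of tuples with unit continuant is multiplicative in the modulus, because each
  coefficient can be split by the Chinese remainder theorem, and lifts from \<open>p\<close> to \<open>p\<^sup>e\<close> with
  factor \<open>p\<^bsup>(e-1)(m-2)\<^esup>\<close>. Modulo \<open>p\<close> the next continuant vanishes for exactly one coefficient if the
  current one is nonzero, and for none otherwise, which gives a linear recurrence.
\<close>

section \<open>Counting tuples with unit continuant\<close>

text \<open>Started at \<open>1 0\<close>, this is the determinant of the tridiagonal matrix with
  the list on its diagonal and ones beside it. Arbitrary starting values let inductions consume the
  list from the front.\<close>

fun continuant :: "int \<Rightarrow> int \<Rightarrow> int list \<Rightarrow> int" where
  "continuant x y [] = x"
| "continuant x y (a # as) = continuant (a * x - y) x as"

text \<open>Keeps only the last two values of the recurrence instead of the list, so that the count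
  becomes a nested sum over residues.\<close>

fun unit_count :: "nat \<Rightarrow> nat \<Rightarrow> int \<Rightarrow> int \<Rightarrow> nat" where
  "unit_count N 0 x y = (if coprime x (int N) then 1 else 0)"
| "unit_count N (Suc k) x y = (\<Sum>a<N. unit_count N k (int a * x - y) x)"

definition unit_lists :: "nat \<Rightarrow> nat \<Rightarrow> int \<Rightarrow> int \<Rightarrow> int list set" where
  "unit_lists N k x y =
     {as. length as = k \<and> set as \<subseteq> {0..<int N} \<and> coprime (continuant x y as) (int N)}"

lemma unit_lists_Suc:
  "unit_lists N (Suc k) x y =
     (\<Union>a<N. (#) (int a) ` unit_lists N k (int a * x - y) x)"
proof (intro equalityI subsetI)
  fix as assume "as \<in> unit_lists N (Suc k) x y"
  then obtain b bs where "as = b # bs" "length bs = k" "0 \<le> b" "b < int N" "set bs \<subseteq> {0..<int N}"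
      "coprime (continuant (b * x - y) x bs) (int N)"
    unfolding unit_lists_def by (cases as) auto
  then show "as \<in> (\<Union>a<N. (#) (int a) ` unit_lists N k (int a * x - y) x)"
    unfolding unit_lists_def by (auto intro!: bexI[of _ "nat b"])
qed (auto simp: unit_lists_def subset_iff)

lemma finite_unit_lists: "finite (unit_lists N k x y)"
  by (rule finite_subset[OF _ finite_lists_length_eq[of "{0..<int N}" k]])
     (auto simp: unit_lists_def)

lemma card_unit_lists: "card (unit_lists N k x y) = unit_count N k x y"
proof (induction k arbitrary: x y)
  case 0
  have "unit_lists N 0 x y = (if coprime x (int N) then {[]} else {})"
    by (auto simp: unit_lists_def)
  then show ?case by simp
next
  case (Suc k)
  have "card (unit_lists N (Suc k) x y) =
      (\<Sum>a<N. card ((#) (int a) ` unit_lists N k (int a * x - y) x))"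
    unfolding unit_lists_Suc
    by (rule card_UN_disjoint) (auto intro: finite_unit_lists)
  also have "\<dots> = (\<Sum>a<N. unit_count N k (int a * x - y) x)"
    by (intro sum.cong refl) (simp add: card_image Suc.IH)
  finally show ?case by simp
qed

section \<open>Reduction to prime moduli\<close>

lemma unit_count_cong:
  assumes "[x = x'] (mod int N)" "[y = y'] (mod int N)"
  shows "unit_count N k x y = unit_count N k x' y'"
  using assms
proof (induction k arbitrary: x y x' y')
  case 0
  then show ?case using cong_imp_coprime cong_sym by (auto, blast+)
next
  case (Suc k)
  then show ?case
    by (auto intro!: sum.cong Suc.IH cong_diff cong_mult)
qed

text \<open>Chinese remainder theorem: \<open>a\<close> corresponds to its pair of residues,
  injectively by coprimality and hence bijectively by cardinality.\<close>

lemma sum_mult_periodic: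
  fixes f g :: "nat \<Rightarrow> nat"
  assumes "coprime M N" "M > 0" "N > 0"
    and f: "\<And>a. f (a mod M) = f a" and g: "\<And>a. g (a mod N) = g a"
  shows "(\<Sum>a<M * N. f a * g a) = (\<Sum>a<M. f a) * (\<Sum>a<N. g a)"
proof -
  let ?h = "\<lambda>a. (a mod M, a mod N)"
  have inj: "inj_on ?h {..<M * N}"
  proof (rule inj_onI)
    fix a b assume ab: "a \<in> {..<M * N}" "b \<in> {..<M * N}" "?h a = ?h b"
    then have "[a = b] (mod M)" "[a = b] (mod N)" by (auto simp: cong_def)
    with assms(1) have "[a = b] (mod M * N)" by (simp add: coprime_cong_mult_nat)
    with ab show "a = b" by (simp add: cong_less_modulus_unique_nat)
  qed
  have "?h ` {..<M * N} = {..<M} \<times> {..<N}"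
    by (rule card_subset_eq) (use assms inj in \<open>auto simp: card_image\<close>)
  then have "bij_betw ?h {..<M * N} ({..<M} \<times> {..<N})"
    using inj by (simp add: bij_betw_def)
  then have "(\<Sum>a<M * N. f (fst (?h a)) * g (snd (?h a))) = (\<Sum>z\<in>{..<M} \<times> {..<N}. f (fst z) * g (snd z))"
    by (rule sum.reindex_bij_betw)
  also have "\<dots> = (\<Sum>a<M. f a) * (\<Sum>a<N. g a)"
    by (simp add: sum_product sum.cartesian_product case_prod_unfold)
  finally show ?thesis by (simp add: f g)
qed

lemma unit_count_mod_eq:
  "unit_count N k (int (a mod N) * x - y) x = unit_count N k (int a * x - y) x"
  by (rule unit_count_cong) (auto intro!: cong_diff cong_mult simp: zmod_int)

lemma unit_count_mult_coprime:
  assumes "coprime M N" "M > 0" "N > 0"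
  shows "unit_count (M * N) k x y = unit_count M k x y * unit_count N k x y"
proof (induction k arbitrary: x y)
  case 0
  then show ?case by simp
next
  case (Suc k)
  show ?case
    by (simp only: unit_count.simps Suc.IH)
       (rule sum_mult_periodic[OF assms]; simp only: unit_count_mod_eq)
qed

lemma sum_periodic:
  fixes f :: "nat \<Rightarrow> nat"
  assumes f: "\<And>a. f (a mod p) = f a"
  shows "(\<Sum>a<t * p. f a) = t * (\<Sum>a<p. f a)"
proof (induction t)
  case (Suc t)
  have "(\<Sum>a<Suc t * p. f a) = (\<Sum>a<t * p. f a) + (\<Sum>a=t*p..<t*p+p. f a)"
    using sum.atLeastLessThan_concat[of 0 "t*p" "t*p+p" f]
    by (simp add: lessThan_atLeast0 algebra_simps)
  also have "(\<Sum>a=t*p..<t*p+p. f a) = (\<Sum>a<p. f (t * p + a))"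
    using sum.shift_bounds_nat_ivl[of f 0 "t*p" p] by (simp add: lessThan_atLeast0 add.commute)
  also have "\<dots> = (\<Sum>a<p. f a)"
    by (intro sum.cong refl) (metis f mod_mult_self3)
  finally show ?case using Suc by simp
qed auto

text \<open>Coprimality to \<open>p ^ e\<close> is coprimality to \<open>p\<close>, so every summand
  has period \<open>p\<close>, and each of the \<open>k\<close> sums runs through
  \<open>p ^ (e - 1)\<close> full periods.\<close>

lemma unit_count_prime_power:
  assumes "prime p" "e > 0"
  shows "unit_count (p ^ e) k x y = p ^ ((e - 1) * k) * unit_count p k x y"
proof (induction k arbitrary: x y)
  case 0
  then show ?case using assms by (simp add: coprime_power_right_iff)
next
  case (Suc k)
  obtain d where e: "e = Suc d" using assms by (cases e) auto
  have "unit_count (p ^ e) (Suc k) x y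
      = p ^ (d * k) * (\<Sum>a<p ^ d * p. unit_count p k (int a * x - y) x)"
    by (simp only: unit_count.simps Suc.IH) (simp add: e sum_distrib_left mult.commute)
  also have "\<dots> = p ^ (d * k) * (p ^ d * (\<Sum>a<p. unit_count p k (int a * x - y) x))"
    by (subst sum_periodic) (simp_all only: unit_count_mod_eq)
  finally show ?case by (simp add: e power_add algebra_simps)
qed

text \<open>Only whether \<open>p\<close> divides \<open>x\<close> matters. From a zero
  \<open>x\<close> all \<open>p\<close> coefficients lead to a nonzero value; from a nonzero
  \<open>x\<close> exactly one leads to zero. This linear recurrence has eigenvalues
  \<open>p\<close> and \<open>-1\<close>. The hypothesis survives the passage to
  \<open>(a * x - y, x)\<close>.\<close>

lemma unit_count_prime:
  assumes p: "prime p" and xy: "\<not> (int p dvd x \<and> int p dvd y)"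
  shows "(real p + 1) * real (unit_count p k x y) =
    (if int p dvd x then real p ^ (k + 1) - real p * (-1) ^ k else real p ^ (k + 1) + (-1) ^ k)"
  using xy
proof (induction k arbitrary: x y)
  case 0
  have "coprime x (int p) \<longleftrightarrow> \<not> int p dvd x"
    using p by (metis coprime_commute prime_imp_coprime prime_nat_int_transfer coprime_absorb_left not_prime_unit)
  then show ?case by simp
next
  case (Suc k)
  let ?F = "\<lambda>a. (real p + 1) * real (unit_count p k (int a * x - y) x)"
  have sum: "(real p + 1) * real (unit_count p (Suc k) x y) = (\<Sum>a<p. ?F a)"
    by (simp add: sum_distrib_left)
  show ?case
  proof (cases "int p dvd x")
    case True
    with Suc.prems have "\<not> int p dvd int a * x - y" for a
      by (metis dvd_diff_right_iff dvd_mult dvd_diff_commute)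
    then have "?F a = real p ^ (k + 1) + (-1) ^ k" for a
      by (subst Suc.IH) auto
    then show ?thesis unfolding sum using True by (simp add: algebra_simps)
  next
    case False
    have cop: "coprime x (int p)"
      using False p by (metis coprime_commute prime_imp_coprime prime_nat_int_transfer)
    then obtain z where z: "[x * z = 1] (mod int p)"
      using cong_solve_coprime_int by blast
    \<comment> \<open>The one coefficient at which \<open>a * x - y\<close> vanishes modulo
      \<open>p\<close>; \<open>z\<close> inverts \<open>x\<close>.\<close>
    define b where "b = nat ((z * y) mod int p)"
    have p0: "p > 0" using p prime_gt_0_nat by blast
    have b: "b < p" "int b = (z * y) mod int p"
      using p0 by (auto simp: b_def nat_less_iff)
    have bx: "[int b * x = y] (mod int p)"
    proof -
      have "[int b * x = (z * y) * x] (mod int p)"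
        unfolding b by (simp add: cong_def mod_mult_left_eq)
      also have "(z * y) * x = (x * z) * y" by simp
      also have "[\<dots> = 1 * y] (mod int p)" by (intro cong_mult z cong_refl)
      finally show ?thesis by simp
    qed
    have dvd: "int p dvd int a * x - y \<longleftrightarrow> a = b" if "a < p" for a
    proof -
      have "int p dvd int a * x - y \<longleftrightarrow> [int a * x = int b * x] (mod int p)"
        using bx by (meson cong_iff_dvd_diff cong_sym cong_trans)
      also have "\<dots> \<longleftrightarrow> [int a = int b] (mod int p)"
        using cop by (simp add: cong_mult_rcancel)
      also have "\<dots> \<longleftrightarrow> a = b"
        using that b by (metis cong_int_iff cong_less_modulus_unique_nat cong_refl)
      finally show ?thesis .
    qed
    have "?F a = (if a = b then real p ^ (k + 1) - real p * (-1) ^ k else real p ^ (k + 1) + (-1) ^ k)"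
      if "a < p" for a
      using that dvd[of a] False by (subst Suc.IH) auto
    \<comment> \<open>The generic value everywhere, plus a correction at \<open>b\<close> equal to
      the difference of the two closed forms.\<close>
    then have "(\<Sum>a<p. ?F a) =
        (\<Sum>a<p. (real p ^ (k + 1) + (-1) ^ k) + (if a = b then - (real p + 1) * (-1) ^ k else 0))"
      by (intro sum.cong refl) (auto simp: algebra_simps)
    also have "\<dots> = real p * (real p ^ (k + 1) + (-1) ^ k) - (real p + 1) * (-1) ^ k"
      using b(1) by (simp add: sum.distrib left_diff_distrib distrib_right)
    finally show ?thesis unfolding sum using False by (simp add: algebra_simps)
  qed
qed

section \<open>Product over the prime divisors\<close>

lemma totient_unit_count_prime_power:
  assumes p: "prime p" and "e > 0"
  shows "real (totient (p ^ e) * unit_count (p ^ e) k 1 0) =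
    real p ^ ((e - 1) * (k + 1)) * (real p ^ (k + 1) + (-1) ^ k) * (real p - 1) / (real p + 1)"
proof -
  have "real (unit_count p k 1 0) = (real p ^ (k + 1) + (-1) ^ k) / (real p + 1)"
    using unit_count_prime[OF p, of 1 0 k] prime_gt_1_nat[OF p] by (simp add: field_simps)
  moreover have "real (p - 1) = real p - 1" using p prime_ge_1_nat by simp
  moreover obtain d where "e = Suc d" using assms(2) by (cases e) auto
  ultimately show ?thesis
    using p by (simp add: totient_prime_power_Suc unit_count_prime_power power_add del: power_Suc)
qed

lemma totient_unit_count_prod:
  assumes "finite S" "\<And>p. p \<in> S \<Longrightarrow> prime p"
  shows "totient (\<Prod>p\<in>S. p ^ e p) * unit_count (\<Prod>p\<in>S. p ^ e p) k 1 0
    = (\<Prod>p\<in>S. totient (p ^ e p) * unit_count (p ^ e p) k 1 0)"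
  using assms
proof (induction S rule: finite_induct)
  case empty
  \<comment> \<open>Modulo 1 there is a single residue, and it is a unit.\<close>
  have "unit_count (Suc 0) k x y = 1" for x y
    by (induction k arbitrary: x y) auto
  then show ?case by simp
next
  case (insert q S)
  have "coprime (q ^ e q) (\<Prod>p\<in>S. p ^ e p)"
    using insert by (intro prod_coprime_right) (metis insertCI primes_coprime coprime_power_left_iff coprime_power_right_iff)
  moreover have "q ^ e q > 0" "(\<Prod>p\<in>S. p ^ e p) > 0"
    using insert by (auto intro!: prod_pos simp: prime_gt_0_nat)
  ultimately show ?case
    using insert by (simp add: totient_mult_coprime unit_count_mult_coprime)
qed

lemma totient_unit_count:
  assumes "n > 0"
  shows "real (totient n * unit_count n k 1 0) =
    (\<Prod>p\<in>prime_factors n. real p ^ ((multiplicity p n - 1) * (k + 1)) *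
        (real p ^ (k + 1) + (-1) ^ k) * (real p - 1) / (real p + 1))"
proof -
  have "real (totient n * unit_count n k 1 0) =
      real (\<Prod>p\<in>prime_factors n. totient (p ^ multiplicity p n) * unit_count (p ^ multiplicity p n) k 1 0)"
    using totient_unit_count_prod[of "prime_factors n" "\<lambda>p. multiplicity p n" k]
      prime_factorization_nat[of n] assms in_prime_factors_imp_prime[of _ n]
    by (simp del: of_nat_mult of_nat_prod)
  also have "\<dots> = (\<Prod>p\<in>prime_factors n. real (totient (p ^ multiplicity p n) * unit_count (p ^ multiplicity p n) k 1 0))"
    by (simp only: of_nat_prod)
  also have "\<dots> = (\<Prod>p\<in>prime_factors n. real p ^ ((multiplicity p n - 1) * (k + 1)) *
        (real p ^ (k + 1) + (-1) ^ k) * (real p - 1) / (real p + 1))"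
    by (intro prod.cong refl totient_unit_count_prime_power)
       (auto simp: prime_factors_multiplicity)
  finally show ?thesis .
qed

section \<open>Continuants as solutions of the recurrence\<close>

lemma continuant_scale: "continuant (c * x) (c * y) as = c * continuant x y as"
proof (induction as arbitrary: x y)
  case (Cons a as)
  have "a * (c * x) - c * y = c * (a * x - y)" by (simp add: algebra_simps)
  then show ?case by (simp add: Cons.IH)
qed simp

lemma continuant_cong:
  assumes "[x = x'] (mod N)" "[y = y'] (mod N)"
  shows "[continuant x y as = continuant x' y' as] (mod N)"
  using assms 
proof (induction as arbitrary: x y x' y')
  case (Cons a as)
  then show ?case by (auto intro!: Cons.IH cong_diff cong_mult)
qed simp

lemma cong_continuant:
  assumes "\<And>i. i < length as \<Longrightarrow> [f (i + 2) = as ! i * f (i + 1) - f i] (mod N)"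
  shows "[f (length as + 1) = continuant (f 1) (f 0) as] (mod N)"
  using assms
proof (induction as arbitrary: f)
  case (Cons a as)
  have "[f (Suc (length as + 1)) = continuant (f (Suc 1)) (f (Suc 0)) as] (mod N)"
  proof (rule Cons.IH)
    fix i assume "i < length as"
    then show "[f (Suc (i + 2)) = as ! i * f (Suc (i + 1)) - f (Suc i)] (mod N)"
      using Cons.prems[of "Suc i"] by simp
  qed
  also have "[continuant (f (Suc 1)) (f (Suc 0)) as = continuant (a * f 1 - f 0) (f 1) as] (mod N)"
    using Cons.prems[of 0] by (intro continuant_cong) (simp_all add: numeral_2_eq_2)
  finally show ?case by simp
qed simp

section \<open>Tame friezes modulo n\<close>

lemma cong_mult_unit_cancel:
  fixes a b c d N :: int
  assumes "[c * d = 1] (mod N)" "[a * c = b * c] (mod N)"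
  shows "[a = b] (mod N)"
proof -
  have "coprime c N" using assms(1) coprime_iff_invertible_int by blast
  then show ?thesis using assms(2) by (simp add: cong_mult_rcancel)
qed

lemma residue_minus_eq:
  assumes "n \<ge> 2"
  shows "x \<ominus>\<^bsub>residue_ring (int n)\<^esub> y = (x - y) mod int n"
proof -
  interpret R: residues "int n" "residue_ring (int n)" using assms by unfold_locales auto
  show ?thesis
    by (simp add: a_minus_def R.res_neg_eq R.res_add_eq mod_simps)
qed

definition det3_int :: "(int \<Rightarrow> int \<Rightarrow> int) \<Rightarrow> int" where
  "det3_int A =
     A 0 0 * (A 1 1 * A 2 2 - A 1 2 * A 2 1) - A 0 1 * (A 1 0 * A 2 2 - A 1 2 * A 2 0)
       + A 0 2 * (A 1 0 * A 2 1 - A 1 1 * A 2 0)"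

lemma det3_int_cong:
  assumes "\<And>i j. i \<in> {0..2} \<Longrightarrow> j \<in> {0..2} \<Longrightarrow> [B i j = C i j] (mod N)"
  shows "[det3_int B = det3_int C] (mod N)"
  unfolding det3_int_def by (intro cong_add cong_diff cong_mult assms) auto

text \<open>The matrix is a product of a 3 by 2 and a 2 by 3 matrix, so its rank is at most
  2.\<close>

lemma det3_int_rank_2: "det3_int (\<lambda>i j. b i * (x i * y' j - x' j * y i)) = 0"
  unfolding det3_int_def by (simp add: algebra_simps)

lemma tame_frieze_residue_ring_iff:
  assumes "n \<ge> 2"
  shows "tame_frieze (residue_ring (int n)) m E \<longleftrightarrow>
    E \<in> frieze_index m \<rightarrow>\<^sub>E {0..<int n} \<and>
    (\<forall>u. E (u, u) = 0 \<and> E (u, u + int m) = 0) \<and>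
    (\<forall>u v. 1 \<le> v - u \<and> v - u \<le> int m - 1 \<longrightarrow>
       [E (u, v) * E (u + 1, v + 1) - E (u + 1, v) * E (u, v + 1) = 1] (mod int n)) \<and>
    (\<forall>u v. 2 \<le> v - u \<and> v - u \<le> int m - 2 \<longrightarrow>
       [det3_int (\<lambda>i j. E (u + i, v + j)) = 0] (mod int n))"
proof -
  interpret R: residues "int n" "residue_ring (int n)" using assms by unfold_locales auto
  have carrier: "carrier (residue_ring (int n)) = {0..<int n}"
    unfolding R.res_carrier_eq by auto
  have one: "1 mod int n = 1" using assms by simp
  have det: "det3 (residue_ring (int n)) A = det3_int A mod int n" for A
    unfolding det3_def det3_int_def
    by (simp add: R.res_mult_eq R.res_add_eq residue_minus_eq[OF assms] mod_simps)
  show ?thesis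
    unfolding tame_frieze_def frieze_def carrier R.res_zero_eq R.res_one_eq det
    by (simp add: R.res_mult_eq residue_minus_eq[OF assms] mod_simps cong_def one)
qed

text \<open>This is \<open>E (v - 1, v + 1)\<close> divided by \<open>E (v - 1, v)\<close>, whose
  inverse is \<open>E (v, v + 1)\<close>: the coefficient that row \<open>v - 1\<close> forces,
  since \<open>E (v - 1, v - 1)\<close> is zero.\<close>

definition quiddity :: "(int \<times> int \<Rightarrow> int) \<Rightarrow> int \<Rightarrow> int" where
  "quiddity E v = E (v - 1, v + 1) * E (v, v + 1)"

section \<open>The three-term recurrence along rows\<close>

locale tame_residue_frieze =
  fixes n m :: nat and E :: "int \<times> int \<Rightarrow> int"
  assumes n: "n \<ge> 2" and m: "m \<ge> 2" and tame: "tame_frieze (residue_ring (int n)) m E"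
begin

lemma extensional_range: "E \<in> frieze_index m \<rightarrow>\<^sub>E {0..<int n}"
  and zero_left: "E (u, u) = 0"
  and zero_right: "E (u, u + int m) = 0"
  and unimodular: "\<lbrakk>u + 1 \<le> v; v \<le> u + int m - 1\<rbrakk> \<Longrightarrow>
       [E (u, v) * E (u + 1, v + 1) - E (u + 1, v) * E (u, v + 1) = 1] (mod int n)"
  and det_zero: "\<lbrakk>u + 2 \<le> v; v \<le> u + int m - 2\<rbrakk> \<Longrightarrow>
       [det3_int (\<lambda>i j. E (u + i, v + j)) = 0] (mod int n)"
  using tame unfolding tame_frieze_residue_ring_iff[OF n] by auto

lemma range: "\<lbrakk>u \<le> v; v \<le> u + int m\<rbrakk> \<Longrightarrow> E (u, v) \<in> {0..<int n}"
  using extensional_range by (auto simp: frieze_index_def)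

lemma first_row_unit: "[E (u, u + 1) * E (u + 1, u + 2) = 1] (mod int n)"
  using unimodular[of u "u + 1"] m zero_left[of "u + 1"] by (simp add: add.commute)

lemma last_row_unit: "[E (u, u + int m - 1) * E (u + 1, u + int m) = 1] (mod int n)"
  using unimodular[of u "u + int m - 1"] m zero_right[of u] by simp

text \<open>Induction on the distance from the diagonal. Distance 1 is the choice of
  \<open>quiddity\<close>, distance 2 compares two neighbouring diamonds, and from distance 3 on
  tameness carries the relation from the two rows \<open>u + 1\<close> and \<open>u + 2\<close> to
  row \<open>u\<close>.\<close>

lemma three_term:
  assumes "u + 1 \<le> v" "v + 1 \<le> u + int m"
  shows "[E (u, v - 1) + E (u, v + 1) = quiddity E v * E (u, v)] (mod int n)"
  using assms
proof (induction "nat (v - u)" arbitrary: u rule: less_induct)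
  case less
  let ?J = "quiddity E v"
  show ?case
  proof (cases "v = u + 1")
    case True
    have "[E (u, u + 2) * 1 = E (u, u + 2) * (E (u, u + 1) * E (u + 1, u + 2))] (mod int n)"
      by (intro cong_mult cong_refl cong_sym[OF first_row_unit])
    then show ?thesis
      using zero_left[of u] True by (simp add: quiddity_def ac_simps)
  next
    case False
    with less.prems have v: "u + 2 \<le> v" by simp
    define x0 x1 x2 where x: "x0 = E (u, v - 1)" "x1 = E (u, v)" "x2 = E (u, v + 1)"
    define y0 y1 y2 where y: "y0 = E (u + 1, v - 1)" "y1 = E (u + 1, v)" "y2 = E (u + 1, v + 1)"
    have Y: "[y0 + y2 = ?J * y1] (mod int n)"
      unfolding y using less.hyps[of "u + 1"] v less.prems by simp
    show ?thesis
    proof (cases "v = u + 2")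
      case True
      have "[x0 * y1 - y0 * x1 = 1] (mod int n)" "[x1 * y2 - y1 * x2 = 1] (mod int n)"
        using unimodular[of u "v - 1"] unimodular[of u v] v less.prems by (simp_all add: x y)
      then have "[(x0 * y1 - y0 * x1) - (x1 * y2 - y1 * x2) = 1 - 1] (mod int n)"
        by (rule cong_diff)
      \<comment> \<open>Adding \<open>x1\<close> times the relation for row \<open>u + 1\<close>
        leaves a multiple of \<open>y1\<close>, which is a unit because it lies next to the zero
        row.\<close>
      then have "[((x0 * y1 - y0 * x1) - (x1 * y2 - y1 * x2)) + x1 * (y0 + y2) = 0 + x1 * (?J * y1)] (mod int n)"
        by (intro cong_add cong_mult cong_refl Y) simp
      then have "[(x0 + x2) * y1 = ?J * x1 * y1] (mod int n)"
        by (simp add: algebra_simps)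
      moreover have "[y1 * E (u + 2, u + 3) = 1] (mod int n)"
        using first_row_unit[of "u + 1"] True by (simp add: y add.commute)
      ultimately show ?thesis
        unfolding x using cong_mult_unit_cancel by blast
    next
      case False
      with v have v3: "u + 3 \<le> v" by simp
      define z0 z1 z2 where z: "z0 = E (u + 2, v - 1)" "z1 = E (u + 2, v)" "z2 = E (u + 2, v + 1)"
      have Z: "[z0 + z2 = ?J * z1] (mod int n)"
        unfolding z using less.hyps[of "u + 2"] v3 less.prems by simp
      have D: "[y0 * z1 - z0 * y1 = 1] (mod int n)"
        using unimodular[of "u + 1" "v - 1"] v3 less.prems by (simp add: y z add.commute)
      have T: "[x0 * (y1 * z2 - y2 * z1) - x1 * (y0 * z2 - y2 * z0) + x2 * (y0 * z1 - y1 * z0) = 0] (mod int n)"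
        using det_zero[of u "v - 1"] v3 less.prems by (simp add: det3_int_def x y z add.commute[of 1])
      define d where "d = x0 + x2 - ?J * x1"
      have "int n dvd d"
      proof -
        let ?Y = "y0 + y2 - ?J * y1" and ?Z = "z0 + z2 - ?J * z1"
        let ?D = "y0 * z1 - z0 * y1 - 1"
        let ?T = "x0 * (y1 * z2 - y2 * z1) - x1 * (y0 * z2 - y2 * z0) + x2 * (y0 * z1 - y1 * z0)"
        \<comment> \<open>Replace the third column by first plus third minus \<open>?J\<close> times
          second. This keeps the determinant \<open>?T\<close>; the new column is
          \<open>d, ?Y, ?Z\<close>, and the cofactor of \<open>d\<close> is
          \<open>?D + 1\<close>.\<close>
        have "d = ?T + ?Y * (x0 * z1 - x1 * z0) - ?Z * (x0 * y1 - x1 * y0) - d * ?D"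
          unfolding d_def by (simp add: algebra_simps)
        moreover have "int n dvd ?T + ?Y * (x0 * z1 - x1 * z0) - ?Z * (x0 * y1 - x1 * y0) - d * ?D"
        proof (rule dvd_diff[OF dvd_diff[OF dvd_add[OF _ dvd_mult2] dvd_mult2] dvd_mult])
        qed (use Y Z D T in \<open>simp_all add: cong_iff_dvd_diff\<close>)
        ultimately show ?thesis by metis
      qed
      then show ?thesis unfolding d_def x cong_iff_dvd_diff .
    qed
  qed
qed

end

text \<open>The first entry and the quiddities next to it determine a row; invertibility along the first
  and last rows then propagates the agreement of two friezes to both neighbouring rows.\<close>

definition agree_at :: "nat \<Rightarrow> nat \<Rightarrow> (int \<times> int \<Rightarrow> int) \<Rightarrow> (int \<times> int \<Rightarrow> int) \<Rightarrow> int \<Rightarrow> bool" where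
  "agree_at n m E E' u \<longleftrightarrow> E (u, u + 1) = E' (u, u + 1) \<and>
     (\<forall>v. u + 1 \<le> v \<and> v \<le> u + int m - 2 \<longrightarrow> [quiddity E v = quiddity E' v] (mod int n))"

section \<open>Uniqueness of a frieze with given initial data\<close>

locale two_tame_residue_friezes =
  F: tame_residue_frieze n m E + F': tame_residue_frieze n m E' for n m E E'
begin

lemma entry_eqI:
  assumes "u \<le> v" "v \<le> u + int m" "[E (u, v) = E' (u, v)] (mod int n)"
  shows "E (u, v) = E' (u, v)"
  using assms F.range[of u v] F'.range[of u v] by (simp add: cong_def)

lemma inverse_entry_eq:
  assumes "u \<le> v" "v \<le> u + int m"
    and "[E (u, v) * E z = 1] (mod int n)" "[E' (u, v) * E' z = 1] (mod int n)" "E z = E' z"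
  shows "E (u, v) = E' (u, v)"
proof (rule entry_eqI[OF assms(1,2)])
  have "[E (u, v) * E z = E' (u, v) * E z] (mod int n)"
    using assms(3-5) by (metis cong_sym cong_trans)
  moreover have "[E z * E (u, v) = 1] (mod int n)" using assms(3) by (simp add: mult.commute)
  ultimately show "[E (u, v) = E' (u, v)] (mod int n)"
    using cong_mult_unit_cancel by blast
qed

lemma agree_row:
  assumes A: "agree_at n m E E' u" and "u \<le> v" "v \<le> u + int m"
  shows "E (u, v) = E' (u, v)"
proof -
  \<comment> \<open>The given quiddities reach column \<open>u + m - 1\<close>; in the remaining
    column \<open>u + m\<close> both friezes are zero.\<close>
  have "j + 1 \<le> m \<Longrightarrow> E (u, u + int j) = E' (u, u + int j)" for j
  proof (induction j rule: induct_nat_012)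
    case 0
    then show ?case using F.zero_left F'.zero_left by simp
  next
    case 1
    then show ?case using A by (simp add: agree_at_def)
  next
    case (ge2 j)
    let ?v = "u + int j + 1"
    have e: "u + int (Suc j) = ?v" "u + int (Suc (Suc j)) = ?v + 1" by auto
    show ?case unfolding e
    proof (rule entry_eqI)
      have "[E (u, ?v - 1) + E (u, ?v + 1) = quiddity E ?v * E (u, ?v)] (mod int n)"
        using ge2.prems by (intro F.three_term) auto
      also have "[quiddity E ?v * E (u, ?v) = quiddity E' ?v * E' (u, ?v)] (mod int n)"
        using ge2 A unfolding e by (intro cong_mult) (auto simp: agree_at_def)
      also have "[quiddity E' ?v * E' (u, ?v) = E' (u, ?v - 1) + E' (u, ?v + 1)] (mod int n)"
        using ge2.prems by (intro cong_sym[OF F'.three_term]) auto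
      finally show "[E (u, ?v + 1) = E' (u, ?v + 1)] (mod int n)"
        using ge2 by (simp add: cong_add_lcancel)
    qed (use ge2.prems in auto)
  qed
  from this[of "nat (v - u)"] show ?thesis
    using assms(2,3) F.zero_right[of u] F'.zero_right[of u] by (cases "v = u + int m") auto
qed

text \<open>Row \<open>u\<close> is already known, and its recurrence at column
  \<open>u + m - 1\<close> can be solved for the quiddity because the entry there is a unit. Row
  \<open>u + 1\<close> needs this extra value.\<close>

lemma agree_quiddity:
  assumes A: "agree_at n m E E' u"
  shows "[quiddity E (u + int m - 1) = quiddity E' (u + int m - 1)] (mod int n)"
proof -
  let ?v = "u + int m - 1"
  have row: "E (u, ?v) = E' (u, ?v)" "E (u, ?v - 1) = E' (u, ?v - 1)" "E (u, ?v + 1) = E' (u, ?v + 1)"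
    using F.m by (auto intro!: agree_row[OF A])
  have "[quiddity E ?v * E (u, ?v) = E (u, ?v - 1) + E (u, ?v + 1)] (mod int n)"
    using F.m by (intro cong_sym[OF F.three_term]) auto
  also have "[E (u, ?v - 1) + E (u, ?v + 1) = quiddity E' ?v * E (u, ?v)] (mod int n)"
    unfolding row using F.m by (intro F'.three_term) auto
  finally show ?thesis
    using F.last_row_unit[of u] cong_mult_unit_cancel by blast
qed

lemma agree_succ:
  assumes A: "agree_at n m E E' u"
  shows "agree_at n m E E' (u + 1)"
  unfolding agree_at_def
proof (intro conjI allI impI)
  have "E (u, u + 1) = E' (u, u + 1)" using A by (simp add: agree_at_def)
  then show "E (u + 1, u + 1 + 1) = E' (u + 1, u + 1 + 1)"
    using F.first_row_unit[of u] F'.first_row_unit[of u] F.m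
    by (intro inverse_entry_eq) (auto simp: mult.commute add.commute)
next
  fix v assume "u + 1 + 1 \<le> v \<and> v \<le> u + 1 + int m - 2"
  then show "[quiddity E v = quiddity E' v] (mod int n)"
    using agree_quiddity[OF A] A by (cases "v = u + int m - 1") (auto simp: agree_at_def)
qed

text \<open>Row \<open>u - 1\<close> is rebuilt from right to left: its last entry is zero, the one
  before is the inverse of \<open>E (u, u + m - 1)\<close>, and the known quiddities run the
  recurrence backwards. The entries in columns \<open>u\<close> and \<open>u + 1\<close> then give
  the missing quiddity at \<open>u\<close>.\<close>

lemma agree_pred:
  assumes A: "agree_at n m E E' u"
  shows "agree_at n m E E' (u - 1)"
proof -
  have row: "E (u, v) = E' (u, v)" if "u \<le> v" "v \<le> u + int m" for v
    using agree_row[OF A] that .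
  have "j + 1 \<le> m \<Longrightarrow> E (u - 1, u + int m - 1 - int j) = E' (u - 1, u + int m - 1 - int j)" for j
  proof (induction j rule: induct_nat_012)
    case 0
    then show ?case using F.zero_right[of "u - 1"] F'.zero_right[of "u - 1"] by (simp add: algebra_simps)
  next
    case 1
    have "[E (u - 1, u + int m - 2) * E (u, u + int m - 1) = 1] (mod int n)"
      "[E' (u - 1, u + int m - 2) * E' (u, u + int m - 1) = 1] (mod int n)"
      using F.last_row_unit[of "u - 1"] F'.last_row_unit[of "u - 1"] by (simp_all add: algebra_simps)
    then have "E (u - 1, u + int m - 2) = E' (u - 1, u + int m - 2)"
      using F.m row[of "u + int m - 1"] by (intro inverse_entry_eq) auto
    then show ?case by simp
  next
    case (ge2 j)
    let ?v = "u + int m - 2 - int j"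
    have e: "u + int m - 1 - int j = ?v + 1" "u + int m - 1 - int (Suc j) = ?v"
      "u + int m - 1 - int (Suc (Suc j)) = ?v - 1" by auto
    show ?case unfolding e
    proof (rule entry_eqI)
      have "[E (u - 1, ?v - 1) + E (u - 1, ?v + 1) = quiddity E ?v * E (u - 1, ?v)] (mod int n)"
        using ge2.prems by (intro F.three_term) auto
      also have "[quiddity E ?v * E (u - 1, ?v) = quiddity E' ?v * E' (u - 1, ?v)] (mod int n)"
        using ge2 A unfolding e by (intro cong_mult) (auto simp: agree_at_def)
      also have "[quiddity E' ?v * E' (u - 1, ?v) = E' (u - 1, ?v - 1) + E' (u - 1, ?v + 1)] (mod int n)"
        using ge2.prems by (intro cong_sym[OF F'.three_term]) auto
      finally show "[E (u - 1, ?v - 1) = E' (u - 1, ?v - 1)] (mod int n)"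
        using ge2 unfolding e by (simp add: cong_add_rcancel)
    qed (use ge2.prems in auto)
  qed
  note left = this
  have "E (u - 1, u) = E' (u - 1, u)" "E (u - 1, u + 1) = E' (u - 1, u + 1)"
    using left[of "m - 1"] left[of "m - 2"] F.m by (auto simp: of_nat_diff)
  moreover have "E (u, u + 1) = E' (u, u + 1)" using A by (simp add: agree_at_def)
  ultimately have "E (u - 1, u - 1 + 1) = E' (u - 1, u - 1 + 1)" "quiddity E u = quiddity E' u"
    by (simp_all add: quiddity_def)
  moreover have "[quiddity E v = quiddity E' v] (mod int n)"
    if "u - 1 + 1 \<le> v" "v \<le> u - 1 + int m - 2" for v
    using A that \<open>quiddity E u = quiddity E' u\<close> by (cases "v = u") (auto simp: agree_at_def)
  ultimately show ?thesis
    unfolding agree_at_def by blast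
qed

lemma agree_imp_eq:
  assumes "agree_at n m E E' 0"
  shows "E = E'"
proof -
  have "agree_at n m E E' u" for u
    using assms by (induction u rule: int_induct[where k = 0]) (auto intro: agree_succ agree_pred)
  then have "E z = E' z" if "z \<in> frieze_index m" for z
    using that agree_row by (auto simp: frieze_index_def)
  then show ?thesis
    using F.extensional_range F'.extensional_range by (rule PiE_ext[rotated 2])
qed

end

section \<open>Constructing a frieze from its code\<close>

text \<open>The starts \<open>0 1\<close> and \<open>1 0\<close> give the two coordinates of the
  path, with first vectors (1,0) and (0,1).\<close>

fun path_coord :: "int list \<Rightarrow> int \<Rightarrow> int \<Rightarrow> nat \<Rightarrow> int" where
  "path_coord as x y 0 = y"
| "path_coord as x y (Suc 0) = x"
| "path_coord as x y (Suc (Suc i)) = as ! i * path_coord as x y (Suc i) - path_coord as x y i"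

lemma path_coord_length: "path_coord as x y (Suc (length as)) = continuant x y as"
  \<comment> \<open>Congruence modulo 0 is equality.\<close>
  using cong_continuant[of as "path_coord as x y" 0] by simp

text \<open>Each step is multiplication by a matrix of determinant 1.\<close>

lemma path_coord_det:
  "path_coord as 0 1 i * path_coord as 1 0 (Suc i) - path_coord as 0 1 (Suc i) * path_coord as 1 0 i = 1"
  by (induction i) (auto simp: algebra_simps)

text \<open>This is \<open>c\<close> to the integer power \<open>e\<close> modulo \<open>N\<close> whenever \<open>d\<close> is an inverse of \<open>c\<close> modulo \<open>N\<close>.\<close>

definition unit_power :: "int \<Rightarrow> int \<Rightarrow> int \<Rightarrow> int" where
  "unit_power c d e = (if e \<ge> 0 then c ^ nat e else d ^ nat (- e))"

lemma unit_power_minus: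
  assumes "[c * d = 1] (mod N)"
  shows "[unit_power c d e * unit_power c d (- e) = 1] (mod N)"
proof -
  have "[(c * d) ^ k = 1] (mod N)" for k using cong_pow[OF assms, of k] by simp
  then show ?thesis by (auto simp: unit_power_def power_mult_distrib mult.commute)
qed

lemma unit_power_add_1:
  assumes "[c * d = 1] (mod N)"
  shows "[unit_power c d (e + 1) = c * unit_power c d e] (mod N)"
proof (cases "e \<ge> 0")
  case True
  then show ?thesis by (simp add: unit_power_def nat_add_distrib)
next
  case False
  define k where "k = nat (- e - 1)"
  with False have e: "e = - int k - 1" by simp
  then have "unit_power c d (e + 1) = d ^ k" "unit_power c d e = d ^ Suc k"
    by (auto simp: unit_power_def nat_add_distrib)
  moreover have "[1 * d ^ k = (c * d) * d ^ k] (mod N)"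
    by (intro cong_mult cong_sym[OF assms] cong_refl)
  ultimately show ?thesis by (simp add: mult.assoc)
qed

lemma unit_power_step:
  assumes "[c * d = 1] (mod N)"
  shows "[unit_power c d (- e) * unit_power c d (e + 1) = c] (mod N)"
proof -
  have "[unit_power c d (- e) * unit_power c d (e + 1) = unit_power c d (- e) * (c * unit_power c d e)] (mod N)"
    by (intro cong_mult cong_refl unit_power_add_1 assms)
  also have "unit_power c d (- e) * (c * unit_power c d e) = c * (unit_power c d e * unit_power c d (- e))"
    by simp
  also have "[c * (unit_power c d e * unit_power c d (- e)) = c * 1] (mod N)"
    by (intro cong_mult cong_refl unit_power_minus assms)
  finally show ?thesis by simp
qed

text \<open>The multiplier \<open>c\<close> is fixed by the seam between periods: the determinant of
  the path vector of index \<open>m - 1\<close> with \<open>c\<close> times (1,0) is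
  \<open>c * - continuant 1 0 as\<close>, which must be 1.\<close>

locale frieze_data =
  fixes n m :: nat and a a' c c' :: int and as :: "int list"
  assumes n: "n \<ge> 2" and m: "m \<ge> 2"
    and a: "0 \<le> a" "a < int n" "[a * a' = 1] (mod int n)"
    and as: "length as = m - 2" "set as \<subseteq> {0..<int n}"
    and c: "[c * - continuant 1 0 as = 1] (mod int n)" "[c * c' = 1] (mod int n)"
begin

text \<open>The vectors \<open>(X i, Y i)\<close> extend the path \<open>w\<^sub>0, \<dots>, w\<^bsub>m-1\<^esub>\<close> so that
  \<open>w\<^bsub>i+m\<^esub>\<close> is \<open>c\<close> times \<open>w\<^sub>i\<close> for even \<open>i\<close> and \<open>c\<^bsup>-1\<^esup>\<close> times \<open>w\<^sub>i\<close> for odd \<open>i\<close>; this is the only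
  way to keep both the zero boundary rows and unit determinants of neighbours. The exponent of
  \<open>c\<close> accumulates over periods if \<open>m\<close> is even and alternates if \<open>m\<close> is odd.\<close>

definition expo :: "int \<Rightarrow> int" where
  "expo i = (if even (i mod int m) then 1 else - 1) *
     (if even m then i div int m else (i div int m) mod 2)"

definition X :: "int \<Rightarrow> int" where
  "X i = unit_power c c' (expo i) * path_coord as 0 1 (nat (i mod int m))"

definition Y :: "int \<Rightarrow> int" where
  "Y i = unit_power c c' (expo i) * path_coord as 1 0 (nat (i mod int m))"

definition D :: "int \<Rightarrow> int \<Rightarrow> int" where
  "D i j = X i * Y j - X j * Y i"

definition A :: "int \<Rightarrow> int" where
  "A i = (if even i then a else a')"

definition built :: "int \<times> int \<Rightarrow> int" where
  "built = restrict (\<lambda>(u, v). (A u * D u v) mod int n) (frieze_index m)"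

lemma A_unit: "[A i * A (i + 1) = 1] (mod int n)"
  using a(3) by (auto simp: A_def mult.commute)

lemma D_period: "D i (i + int m) = 0"
  by (simp add: D_def X_def Y_def)

text \<open>Within a period neighbouring exponents of \<open>c\<close> are opposite and cancel.
  Across a seam they add up to 1, and the resulting \<open>c\<close> cancels the minus
  continuant.\<close>

lemma D_succ: "[D i (i + 1) = 1] (mod int n)"
proof -
  define q r where qr: "q = i div int m" "r = i mod int m"
  have i: "i = q * int m + r" and r: "0 \<le> r" "r < int m"
    using m by (auto simp: qr)
  let ?u = "unit_power c c'"
  have D: "D i (i + 1) = ?u (expo i) * ?u (expo (i + 1)) *
    (path_coord as 0 1 (nat r) * path_coord as 1 0 (nat ((i + 1) mod int m)) -
     path_coord as 0 1 (nat ((i + 1) mod int m)) * path_coord as 1 0 (nat r))"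
    by (simp add: D_def X_def Y_def qr algebra_simps)
  show ?thesis
  proof (cases "r + 1 < int m")
    case True
    then have s: "(i + 1) mod int m = r + 1" "(i + 1) div int m = q"
      using r by (auto intro!: int_mod_pos_eq[where q = q] int_div_pos_eq[where r = "r + 1"] simp: i)
    have "expo (i + 1) = - expo i"
      by (simp add: expo_def s flip: qr)
    then have "D i (i + 1) = ?u (expo i) * ?u (- expo i)"
      unfolding D s using path_coord_det[of as "nat r"] r by (simp add: nat_add_distrib)
    then show ?thesis using unit_power_minus[OF c(2)] by simp
  next
    case False
    then have rm: "r = int m - 1" using r by simp
    then have s: "(i + 1) mod int m = 0" "(i + 1) div int m = q + 1"
      using m by (auto intro!: int_mod_pos_eq[where q = "q + 1"] int_div_pos_eq[where r = 0] simp: i algebra_simps)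
    have "nat r = Suc (length as)" using as m rm by auto
    then have D': "D i (i + 1) = ?u (expo i) * ?u (expo (i + 1)) * - continuant 1 0 as"
      unfolding D s by (simp add: path_coord_length)
    have "[?u (expo i) * ?u (expo (i + 1)) = c] (mod int n)"
    proof (cases "even m")
      case True
      then have "odd r" using rm by simp
      then have "expo i = - q" "expo (i + 1) = q + 1"
        using True by (simp_all add: expo_def s flip: qr)
      then show ?thesis using unit_power_step[OF c(2)] by simp
    next
      case False
      then have "even r" using rm m by simp
      have q2: "(q + 1) mod 2 = 1 - q mod 2" by presburger
      from \<open>even r\<close> have "expo i = q mod 2" "expo (i + 1) = 1 - q mod 2"
        using False q2 by (simp_all add: expo_def s flip: qr)
      then show ?thesis
        by (cases "even q") (auto simp: unit_power_def odd_iff_mod_2_eq_one even_iff_mod_2_eq_zero)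
    qed
    then have "[D i (i + 1) = c * - continuant 1 0 as] (mod int n)"
      unfolding D' by (rule cong_mult) simp
    then show ?thesis using c(1) cong_trans by blast
  qed
qed

text \<open>Pluecker relation for four plane vectors; with \<open>u + 1\<close> and
  \<open>v + 1\<close> for \<open>u'\<close> and \<open>v'\<close> it reduces the diamond rule to
  \<open>D_succ\<close>.\<close>

lemma plucker: "D u v * D u' v' - D u' v * D u v' = D u u' * D v v'"
  by (simp add: D_def algebra_simps)

lemma built_eq:
  assumes "u \<le> v" "v \<le> u + int m"
  shows "built (u, v) = (A u * D u v) mod int n"
  using assms by (simp add: built_def frieze_index_def)

lemma built_cong:
  assumes "u \<le> v" "v \<le> u + int m"
  shows "[built (u, v) = A u * D u v] (mod int n)"
  by (simp add: built_eq[OF assms])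

lemma tame_built: "tame_frieze (residue_ring (int n)) m built"
  unfolding tame_frieze_residue_ring_iff[OF n]
proof (intro conjI allI impI)
  show "built \<in> frieze_index m \<rightarrow>\<^sub>E {0..<int n}"
    using n by (auto simp: built_def)
  show "built (u, u) = 0" for u by (simp add: built_eq D_def)
  show "built (u, u + int m) = 0" for u by (simp add: built_eq D_period)
next
  fix u v :: int assume uv: "1 \<le> v - u \<and> v - u \<le> int m - 1"
  have "[built (u, v) * built (u + 1, v + 1) - built (u + 1, v) * built (u, v + 1) =
      (A u * D u v) * (A (u + 1) * D (u + 1) (v + 1)) - (A (u + 1) * D (u + 1) v) * (A u * D u (v + 1))] (mod int n)"
    using uv by (intro cong_diff cong_mult built_cong) auto
  also have "(A u * D u v) * (A (u + 1) * D (u + 1) (v + 1)) - (A (u + 1) * D (u + 1) v) * (A u * D u (v + 1))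
      = (A u * A (u + 1)) * (D u (u + 1) * D v (v + 1))"
    unfolding plucker[of u v "u + 1" "v + 1", symmetric] by (simp add: algebra_simps)
  also have "[(A u * A (u + 1)) * (D u (u + 1) * D v (v + 1)) = 1 * (1 * 1)] (mod int n)"
    by (intro cong_mult A_unit D_succ)
  finally show "[built (u, v) * built (u + 1, v + 1) - built (u + 1, v) * built (u, v + 1) = 1] (mod int n)"
    by simp
next
  fix u v :: int assume uv: "2 \<le> v - u \<and> v - u \<le> int m - 2"
  have "[det3_int (\<lambda>i j. built (u + i, v + j)) = det3_int (\<lambda>i j. A (u + i) * D (u + i) (v + j))] (mod int n)"
    using uv by (intro det3_int_cong built_cong) auto
  also have "det3_int (\<lambda>i j. A (u + i) * D (u + i) (v + j)) = 0"
    unfolding D_def by (rule det3_int_rank_2)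
  finally show "[det3_int (\<lambda>i j. built (u + i, v + j)) = 0] (mod int n)" .
qed

text \<open>In the first period \<open>expo\<close> is zero, so no power of \<open>c\<close>
  appears.\<close>

lemma D_small:
  assumes "0 \<le> i" "i < int m" "0 \<le> j" "j < int m"
  shows "D i j = path_coord as 0 1 (nat i) * path_coord as 1 0 (nat j) -
    path_coord as 0 1 (nat j) * path_coord as 1 0 (nat i)"
  using assms by (simp add: D_def X_def Y_def expo_def unit_power_def)

lemma built_first: "built (0, 1) = a"
  using m a by (simp add: built_eq D_small A_def)

text \<open>The recurrence gives \<open>D i (i + 2)\<close> as \<open>as ! i\<close> times a
  determinant equal to 1, and the factors \<open>A\<close> cancel. The bound keeps
  \<open>i + 2\<close> in the first period.\<close>

lemma quiddity_built:
  assumes "i < m - 2"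
  shows "quiddity built (int i + 1) mod int n = as ! i"
proof -
  let ?v = "int i + 1"
  have v: "?v - 1 = int i" "?v = int (Suc i)" "?v + 1 = int (Suc (Suc i))" by auto
  have "D (int i) (int (Suc (Suc i))) = as ! i *
      (path_coord as 0 1 i * path_coord as 1 0 (Suc i) - path_coord as 0 1 (Suc i) * path_coord as 1 0 i)"
    using assms by (subst D_small) (auto simp: nat_add_distrib algebra_simps)
  then have D2: "D (int i) (int (Suc (Suc i))) = as ! i" by (simp only: path_coord_det)
  have "[quiddity built ?v = (A (int i) * D (int i) (int (Suc (Suc i)))) *
      (A (int i + 1) * D ?v (?v + 1))] (mod int n)"
    unfolding quiddity_def using assms v by (auto intro!: cong_mult built_cong)
  also have "(A (int i) * D (int i) (int (Suc (Suc i)))) * (A (int i + 1) * D ?v (?v + 1))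
      = as ! i * ((A (int i) * A (int i + 1)) * D ?v (?v + 1))"
    by (simp only: D2 ac_simps)
  also have "[as ! i * ((A (int i) * A (int i + 1)) * D ?v (?v + 1)) = as ! i * (1 * 1)] (mod int n)"
    by (intro cong_mult cong_refl A_unit D_succ)
  finally have "[quiddity built ?v = as ! i] (mod int n)" by simp
  moreover have "as ! i \<in> {0..<int n}" using as assms by (metis nth_mem subsetD)
  ultimately show ?thesis by (simp add: cong_def)
qed

end

section \<open>The bijection\<close>

text \<open>Position \<open>i\<close> holds the quiddity at \<open>i + 1\<close>, reduced because a
  product of two entries need not be a reduced residue.\<close>

definition frieze_code :: "nat \<Rightarrow> nat \<Rightarrow> (int \<times> int \<Rightarrow> int) \<Rightarrow> int \<times> int list" where
  "frieze_code n m E = (E (0, 1), map (\<lambda>i. quiddity E (int i + 1) mod int n) [0..<m - 2])"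

text \<open>Row 0 starts with \<open>0\<close> and \<open>E (0, 1)\<close>, so linearity of the
  continuant writes the unit \<open>E (0, m - 1)\<close> as \<open>E (0, 1)\<close> times the
  continuant of the code.\<close>

lemma (in tame_residue_frieze) frieze_code_in:
  "frieze_code n m E \<in> {a \<in> {0..<int n}. coprime a (int n)} \<times> unit_lists n (m - 2) 1 0"
proof -
  let ?as = "map (\<lambda>i. quiddity E (int i + 1) mod int n) [0..<m - 2]"
  define f where "f i = E (0, int i)" for i
  have "[f (length ?as + 1) = continuant (f 1) (f 0) ?as] (mod int n)"
  proof (rule cong_continuant)
    fix i assume i: "i < length ?as"
    have "[f i + f (i + 2) = quiddity E (int i + 1) * f (i + 1)] (mod int n)"
      using three_term[of 0 "int i + 1"] i by (simp add: f_def add.commute)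
    also have "[quiddity E (int i + 1) * f (i + 1) = ?as ! i * f (i + 1)] (mod int n)"
      using i by (intro cong_mult) auto
    finally have "[f i + f (i + 2) - f i = ?as ! i * f (i + 1) - f i] (mod int n)"
      by (rule cong_diff) simp
    then show "[f (i + 2) = ?as ! i * f (i + 1) - f i] (mod int n)" by simp
  qed
  moreover have "continuant (f 1) (f 0) ?as = f 1 * continuant 1 0 ?as"
    using continuant_scale[of "f 1" 1 0 ?as] zero_left[of 0] by (simp add: f_def)
  moreover have "length ?as + 1 = m - 1" using m by simp
  ultimately have "[f (m - 1) = f 1 * continuant 1 0 ?as] (mod int n)" by metis
  moreover have "coprime (f (m - 1)) (int n)"
    using last_row_unit[of 0] m coprime_iff_invertible_int by (auto simp: f_def of_nat_diff)
  ultimately have "coprime (f 1 * continuant 1 0 ?as) (int n)"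
    using cong_imp_coprime by blast
  then show ?thesis
    using range[of 0 1] m n by (auto simp: frieze_code_def unit_lists_def f_def)
qed

lemma inj_frieze_code:
  assumes "n \<ge> 2" "m \<ge> 2"
  shows "inj_on (frieze_code n m) {E. tame_frieze (residue_ring (int n)) m E}"
proof (rule inj_onI)
  fix E E' assume *: "E \<in> {E. tame_frieze (residue_ring (int n)) m E}"
    "E' \<in> {E. tame_frieze (residue_ring (int n)) m E}" "frieze_code n m E = frieze_code n m E'"
  then interpret two_tame_residue_friezes n m E E'
    using assms by unfold_locales auto
  have q: "[quiddity E (int i + 1) = quiddity E' (int i + 1)] (mod int n)" if "i < m - 2" for i
    using *(3) that by (auto simp: frieze_code_def cong_def)
  have "agree_at n m E E' 0"
    unfolding agree_at_def
  proof (intro conjI allI impI)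
    show "E (0, 0 + 1) = E' (0, 0 + 1)" using *(3) by (simp add: frieze_code_def)
    fix v :: int assume "0 + 1 \<le> v \<and> v \<le> 0 + int m - 2"
    then show "[quiddity E v = quiddity E' v] (mod int n)"
      using q[of "nat (v - 1)"] by (simp add: nat_less_iff of_nat_diff F.m)
  qed
  then show "E = E'" by (rule agree_imp_eq)
qed

lemma frieze_code_surj:
  assumes "n \<ge> 2" "m \<ge> 2" "0 \<le> a" "a < int n" "coprime a (int n)" "as \<in> unit_lists n (m - 2) 1 0"
  shows "\<exists>E. tame_frieze (residue_ring (int n)) m E \<and> frieze_code n m E = (a, as)"
proof -
  obtain a' where "[a * a' = 1] (mod int n)"
    using assms coprime_iff_invertible_int by blast
  moreover obtain c where c: "[- continuant 1 0 as * c = 1] (mod int n)"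
    using assms(6) coprime_iff_invertible_int[of "- continuant 1 0 as" "int n"]
    by (auto simp: unit_lists_def)
  \<comment> \<open>The multiplier inverts the minus continuant, so the minus continuant serves as
    its inverse \<open>c'\<close>.\<close>
  ultimately interpret frieze_data n m a a' c "- continuant 1 0 as" as
    using assms by unfold_locales (auto simp: unit_lists_def mult.commute)
  have "map (\<lambda>i. quiddity built (int i + 1) mod int n) [0..<m - 2] = as"
    using as quiddity_built by (intro nth_equalityI) auto
  then show ?thesis
    using tame_built built_first by (auto simp: frieze_code_def)
qed

lemma card_coprime_residues:
  assumes "n \<ge> 2"
  shows "card {a \<in> {0..<int n}. coprime a (int n)} = totient n"
proof -
  interpret residues "int n" "residue_ring (int n)" using assms by unfold_locales auto
  have "{a \<in> {0..<int n}. coprime a (int n)} = Units (residue_ring (int n))"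
    using assms by (auto simp: res_units_eq order_le_less)
  then show ?thesis using totient_eq by simp
qed

lemma card_tame_friezes:
  assumes "n \<ge> 2" "m \<ge> 2"
  shows "card {E. tame_frieze (residue_ring (int n)) m E} = totient n * unit_count n (m - 2) 1 0"
proof -
  let ?T = "{E. tame_frieze (residue_ring (int n)) m E}"
  let ?C = "{a \<in> {0..<int n}. coprime a (int n)} \<times> unit_lists n (m - 2) 1 0"
  have "frieze_code n m ` ?T = ?C"
  proof
    show "frieze_code n m ` ?T \<subseteq> ?C"
      using assms tame_residue_frieze.frieze_code_in tame_residue_frieze.intro by blast
    show "?C \<subseteq> frieze_code n m ` ?T"
      using frieze_code_surj[OF assms] by (force simp: image_iff)
  qed
  then have "card ?T = card ?C"
    using card_image[OF inj_frieze_code[OF assms]] by simp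
  then show ?thesis
    by (simp only: card_cartesian_product card_coprime_residues[OF assms(1)] card_unit_lists)
qed

theorem theoremA:
  fixes n m :: nat
  assumes "n \<ge> 2" and "m \<ge> 2"
  shows "real (card {E. tame_frieze (residue_ring (int n)) m E}) =
    (\<Prod>p\<in>prime_factors n.
       real p ^ ((multiplicity p n - 1) * (m - 1)) * (real p ^ (m - 1) + (-1) ^ m) * (real p - 1)
         / (real p + 1))"
proof -
  \<comment> \<open>With this \<open>k\<close>, the exponent \<open>k + 1\<close> is
    \<open>m - 1\<close>, and the sign keeps its parity.\<close>
  obtain k where k: "m = k + 2"
    using assms(2) le_Suc_ex by (metis add.commute)
  show ?thesis
    using totient_unit_count[of n k] assms(1)
    by (simp only: card_tame_friezes[OF assms]) (simp add: k)
qed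

end
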